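(* Let $q=p^s$ with $p$ an odd prime and $s\ge1$, let $n\geq 1$, let $a_1,\dots,a_n\in\mathbb{F}_q^*$, and let $$N^*(n,0)=\#\{(x_1,\dots,x_n)\in(\mathbb{F}_q^* )^n\mid a_1x_1^2+\cdots+a_nx_n^2=0\}.$$ Let $\chi$ be the quadratic character of $\mathbb{F}_q^*$ and $m=\#\{1\le i\le n\mid \chi(a_i)=1\}$. (1) If either $p\equiv1\pmod4$, or $p\equiv3\pmod4$ and $s$ is even, then $$N^*(n,0)=\frac{(q-1)^n}{q}+(-1)^n\frac{q-1}{2q}\Big[(1-\sqrt q)^{m}(1+\sqrt q)^{n-m}+(1+\sqrt q)^{m}(1-\sqrt q)^{n-m}\Big].$$ (2) If $p\equiv3\pmod4$ and $s$ is odd, then $$N^*(n,0)=\frac{(q-1)^n}{q}+(-1)^n\frac{q-1}{2q}\Big[(1-\sqrt q i)^{m}(1+\sqrt q i)^{n-m}+(1+\sqrt q i)^{m}(1-\sqrt q i)^{n-m}\Big],$$ where $i=\sqrt{-1}$. *)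

theory Defs
  imports "HOL-Analysis.Analysis" "HOL-Computational_Algebra.Primes"
begin

definition quadratic_character :: "'a :: finite_field \<Rightarrow> int" where
  "quadratic_character a =
     (if a = 0 then 0 else if \<exists>b. a = b\<^sup>2 then 1 else -1)"

text \<open>
  Points of $(\mathbb{F}_q^*)^n$ are functions on \<open>{1..n}\<close> that are \<open>undefined\<close> elsewhere
  (\<open>\<rightarrow>\<^sub>E\<close>), so that each tuple is counted once.
\<close>
definition N_star :: "nat \<Rightarrow> (nat \<Rightarrow> 'a :: finite_field) \<Rightarrow> 'a \<Rightarrow> nat" where
  "N_star n a b =
     card {x \<in> {1..n} \<rightarrow>\<^sub>E (UNIV - {0}). (\<Sum>i=1..n. a i * x i ^ 2) = b}"

end

theory Submission
  imports Defs
begin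

text \<open>
  Write \<open>\<eta>\<close> for the quadratic character and \<open>\<epsilon> = \<eta> (-1)\<close>. As a function of \<open>b\<close>, the number of
  solutions of \<open>a\<^sub>1 x\<^sub>1\<^sup>2 + \<dots> + a\<^sub>n x\<^sub>n\<^sup>2 = b\<close> in nonzero \<open>x\<^sub>i\<close> is a combination of the constant \<open>1\<close>,
  of \<open>u b = q [b = 0] - 1\<close> and of \<open>\<eta>\<close>. Adding a variable with coefficient \<open>c\<close> multiplies \<open>1\<close> by
  \<open>q - 1\<close>, and sends \<open>u\<close> to \<open>- u + \<eta> c q \<eta>\<close> and \<open>\<eta>\<close> to \<open>- \<eta> + \<eta> c \<epsilon> u\<close>, the latter by the
  evaluation of the Jacobi sum \<open>\<Sum>y. \<eta> y \<eta> (b - y) = \<epsilon> u b\<close>. If \<open>w\<^sup>2 = \<epsilon> q\<close>, this map on the span of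
  \<open>u\<close> and \<open>\<eta>\<close> has the eigenvalues \<open>\<plusminus> \<eta> c w - 1\<close> on eigenvectors independent
  of \<open>c\<close>, which yields the product formula. Finally \<open>\<epsilon> = 1\<close> iff \<open>q \<equiv> 1 (mod 4)\<close>,
  by counting the fixed points of inversion on the nonzero squares.
\<close>

section \<open>Parity arguments and odd characteristic\<close>

text \<open>The two-element orbits \<open>{x, f x}\<close> partition \<open>A\<close>; the induction
  removes one orbit at a time.\<close>

lemma even_card_involution:
  assumes "finite A" and "\<And>x. x \<in> A \<Longrightarrow> f x \<in> A \<and> f x \<noteq> x \<and> f (f x) = x"
  shows "even (card A)"
  using assms
proof (induction A rule: finite_psubset_induct)
  case (psubset A)
  show ?case
  proof (cases "A = {}")
    case False
    then obtain x where x: "x \<in> A" by blast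
    let ?B = "A - {x, f x}"
    have "even (card ?B)"
    proof (rule psubset.IH)
      show "?B \<subset> A" using x by blast
      show "f y \<in> ?B \<and> f y \<noteq> y \<and> f (f y) = y" if "y \<in> ?B" for y
        using that x psubset.prems by (metis Diff_iff insert_iff singletonD)
    qed
    moreover have "card A = card ?B + card {x, f x}"
      using psubset.hyps psubset.prems[OF x] x
      by (metis card_Diff_subset card_mono empty_subsetI finite.emptyI finite.insertI
          insert_subset le_add_diff_inverse2)
    moreover have "card {x, f x} = 2" using psubset.prems[OF x] by (metis card_2_iff)
    ultimately show ?thesis by simp
  qed simp
qed

text \<open>Otherwise translation by 1 would be an involution of the field without fixed
  points.\<close>

lemma one_neq_minus_one_if_odd_card:
  assumes "odd (CARD('a :: finite_field))"
  shows "(1 :: 'a) \<noteq> - 1"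
proof
  assume "(1 :: 'a) = - 1"
  then have "(1 :: 'a) + 1 = 0" by (metis add.right_inverse)
  then have "x + 1 + 1 = x" for x :: 'a by (simp add: add.assoc)
  then have "even (CARD('a))"
    by (intro even_card_involution[where f = "\<lambda>x. x + 1"]) auto
  with assms show False by simp
qed

section \<open>The quadratic character and sums over squares\<close>

lemma quadratic_character_0 [simp]: "quadratic_character 0 = 0"
  by (simp add: quadratic_character_def)

lemma quadratic_character_power2 [simp]: "x \<noteq> 0 \<Longrightarrow> quadratic_character (x\<^sup>2) = 1"
  by (auto simp: quadratic_character_def)

lemma quadratic_character_1 [simp]: "quadratic_character 1 = 1"
  using quadratic_character_power2[of 1] by simp

lemma quadratic_character_nonzero:
  "x \<noteq> 0 \<Longrightarrow> quadratic_character x = 1 \<or> quadratic_character x = - 1"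
  by (auto simp: quadratic_character_def)

lemma quadratic_character_eq_1_iff:
  "quadratic_character x = 1 \<longleftrightarrow> (\<exists>y. y \<noteq> 0 \<and> x = y\<^sup>2)"
  by (auto simp: quadratic_character_def)

lemma quadratic_character_mult_square:
  assumes "quadratic_character x = 1"
  shows "quadratic_character (x * y) = quadratic_character y"
proof -
  obtain z where z: "z \<noteq> 0" "x = z\<^sup>2"
    using assms by (auto simp: quadratic_character_eq_1_iff)
  have "(\<exists>u. x * y = u\<^sup>2) \<longleftrightarrow> (\<exists>u. y = u\<^sup>2)"
  proof
    assume "\<exists>u. x * y = u\<^sup>2"
    then obtain u where "x * y = u\<^sup>2" by blast
    then have "y = (u / z)\<^sup>2" using z by (simp add: power_divide field_simps)
    then show "\<exists>u. y = u\<^sup>2" by blast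
  next
    assume "\<exists>u. y = u\<^sup>2"
    then show "\<exists>u. x * y = u\<^sup>2" using z by (metis power_mult_distrib)
  qed
  then show ?thesis using z by (simp add: quadratic_character_def)
qed

lemma card_square_roots:
  fixes y :: "'a :: finite_field"
  assumes "(1 :: 'a) \<noteq> - 1"
  shows "int (card {x. x\<^sup>2 = y}) = 1 + quadratic_character y"
proof (cases "\<exists>u. y = u\<^sup>2")
  case True
  then obtain u where u: "y = u\<^sup>2" by blast
  have eq: "{x. x\<^sup>2 = y} = {u, - u}" by (auto simp: u power2_eq_iff)
  show ?thesis
  proof (cases "u = 0")
    case False
    have "u \<noteq> - u"
    proof
      assume "u = - u"
      then have "1 = u / u" "- 1 = - u / u" using False by auto
      with \<open>u = - u\<close> assms show False by metis
    qed
    then have "card {u, - u} = 2" by simp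
    with False show ?thesis unfolding eq by (simp add: u)
  qed (unfold eq, simp add: u)
next
  case False
  then have "{x. x\<^sup>2 = y} = {}" "y \<noteq> 0" by (auto simp: power2_eq_square)
  with False show ?thesis by (simp add: quadratic_character_def)
qed

text \<open>Group the \<open>x\<close> by their square; the fibre sizes come from
  \<open>card_square_roots\<close>.\<close>

lemma sum_over_squares:
  fixes f :: "'a :: finite_field \<Rightarrow> 'b :: comm_ring_1"
  assumes "(1 :: 'a) \<noteq> - 1"
  shows "(\<Sum>x\<in>UNIV. f (x\<^sup>2)) = (\<Sum>y\<in>UNIV. (1 + of_int (quadratic_character y)) * f y)"
proof -
  have "(\<Sum>x\<in>UNIV. f (x\<^sup>2)) = (\<Sum>y\<in>UNIV. \<Sum>x\<in>{x\<in>UNIV. x\<^sup>2 = y}. f (x\<^sup>2))"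
    by (rule sum.group[symmetric]) auto
  also have "\<dots> = (\<Sum>y\<in>UNIV. of_int (int (card {x. x\<^sup>2 = y})) * f y)"
    by (intro sum.cong) auto
  finally show ?thesis by (simp only: card_square_roots[OF assms] of_int_add of_int_1)
qed

lemma sum_quadratic_character:
  assumes "(1 :: 'a) \<noteq> - 1"
  shows "(\<Sum>x\<in>(UNIV :: 'a :: finite_field set). quadratic_character x) = 0"
  using sum_over_squares[OF assms, of "\<lambda>_. 1 :: int"] by (simp add: sum.distrib)

text \<open>Only two non-squares pose a problem, and they are handled without a primitive root.
  Multiplication by a non-square \<open>x\<close> permutes the field and sends nonzero squares to
  non-squares; since the character sums to 0, non-squares must go to squares.\<close>

lemma quadratic_character_mult:
  fixes x y :: "'a :: finite_field"
  assumes "(1 :: 'a) \<noteq> - 1"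
  shows "quadratic_character (x * y) = quadratic_character x * quadratic_character y"
proof (cases "x = 0 \<or> y = 0 \<or> quadratic_character x = 1")
  case True
  then show ?thesis by (auto simp: quadratic_character_mult_square)
next
  case False
  then have x: "x \<noteq> 0" "quadratic_character x = - 1"
    using quadratic_character_nonzero by blast+
  \<comment> \<open>No summand below is positive and the sum vanishes, so every summand does.\<close>
  let ?g = "\<lambda>z. quadratic_character (x * z) + quadratic_character z"
  have le: "?g z \<le> 0" for z
  proof (cases "quadratic_character z = 1")
    case True
    then show ?thesis using quadratic_character_mult_square[OF True, of x] x by (simp add: mult.commute)
  next
    case False
    then show ?thesis
      using quadratic_character_nonzero[of z] quadratic_character_nonzero[of "x * z"] x
      by (cases "z = 0") auto
  qed
  have "bij ((*) x)"
    by (rule bij_betw_byWitness[where f' = "\<lambda>z. z / x"]) (use x in auto)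
  then have "(\<Sum>z\<in>UNIV. quadratic_character (x * z)) =
      (\<Sum>z\<in>(UNIV :: 'a set). quadratic_character z)"
    by (rule sum.reindex_bij_betw)
  then have "(\<Sum>z\<in>UNIV. ?g z) = 0"
    by (simp add: sum.distrib sum_quadratic_character[OF assms])
  then have "(\<Sum>z\<in>UNIV. - ?g z) = 0" by (simp only: sum_negf)
  then have "\<forall>z\<in>UNIV. - ?g z = 0"
    by (subst (asm) sum_nonneg_eq_0_iff) (use le in \<open>auto simp del: minus_add_distrib\<close>)
  then have "?g y = 0" by (metis UNIV_I neg_equal_0_iff_equal)
  then show ?thesis using x by simp
qed

lemma quadratic_character_mult_self:
  "x \<noteq> 0 \<Longrightarrow> quadratic_character x * quadratic_character x = 1"
  using quadratic_character_nonzero[of x] by auto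

section \<open>The Jacobi sum and the character at -1\<close>

lemma sum_reflect:
  fixes f :: "'a :: {finite, ab_group_add} \<Rightarrow> 'b :: comm_monoid_add"
  shows "(\<Sum>y\<in>UNIV. f (b - y)) = (\<Sum>y\<in>UNIV. f y)"
  by (rule sum.reindex_bij_witness[of _ "\<lambda>y. b - y" "\<lambda>y. b - y"]) auto

text \<open>Pulling the square of \<open>y\<close> out of \<open>y * (b - y)\<close> leaves the
  character at \<open>b / y - 1\<close>. This is constantly -1 if \<open>b = 0\<close>, and
  otherwise takes every value except -1 exactly once.\<close>

lemma jacobi_sum_quadratic_character:
  fixes b :: "'a :: finite_field"
  assumes "(1 :: 'a) \<noteq> - 1"
  shows "(\<Sum>y\<in>UNIV. quadratic_character y * quadratic_character (b - y)) =
           quadratic_character (- 1 :: 'a) * (int CARD('a) * of_bool (b = 0) - 1)"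
proof -
  note mult = quadratic_character_mult[OF assms]
  let ?c = "quadratic_character :: 'a \<Rightarrow> int"
  have ratio: "?c y * ?c (b - y) = ?c (b / y - 1)" if "y \<noteq> 0" for y
  proof -
    have "b - y = y * (b / y - 1)" using that by (simp add: field_simps)
    then have "?c (b - y) = ?c y * ?c (b / y - 1)" by (metis mult)
    then have "?c y * ?c (b - y) = (?c y * ?c y) * ?c (b / y - 1)" by simp
    then show ?thesis by (simp add: quadratic_character_mult_self that)
  qed
  have "(\<Sum>y\<in>UNIV. ?c y * ?c (b - y)) = (\<Sum>y\<in>UNIV - {0}. ?c y * ?c (b - y))"
    by (rule sum.mono_neutral_right) auto
  also have "\<dots> = (\<Sum>y\<in>UNIV - {0}. ?c (b / y - 1))"
    by (intro sum.cong) (auto simp: ratio)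
  also have "\<dots> = ?c (- 1) * (int CARD('a) * of_bool (b = 0) - 1)"
  proof (cases "b = 0")
    case True
    have "CARD('a) \<ge> 1" by (simp add: Suc_leI)
    with True show ?thesis by (simp add: card_Diff_subset of_nat_diff mult.commute)
  next
    case False
    have "(\<Sum>y\<in>UNIV - {0}. ?c (b / y - 1)) = (\<Sum>z\<in>UNIV - {- 1}. ?c z)"
      by (rule sum.reindex_bij_witness[of _ "\<lambda>z. b / (z + 1)" "\<lambda>y. b / y - 1"])
        (use False in \<open>auto simp: add_eq_0_iff2\<close>)
    also have "\<dots> = - ?c (- 1)"
      using sum_quadratic_character[OF assms] by (simp add: sum_diff1)
    finally show ?thesis using False by simp
  qed
  finally show ?thesis .
qed

lemma quadratic_character_minus_1:
  assumes "odd CARD('a :: finite_field)"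
  shows "quadratic_character (- 1 :: 'a) = (if CARD('a) mod 4 = 1 then 1 else - 1)"
proof -
  have neq: "(1 :: 'a) \<noteq> - 1" using one_neq_minus_one_if_odd_card[OF assms] .
  define S where "S = {x :: 'a. quadratic_character x = 1}"
  \<comment> \<open>A single expression for all three values, so that the vanishing character sum
    gives \<open>2 * card S + 1 = CARD('a)\<close>.\<close>
  have c: "quadratic_character x = 2 * of_bool (x \<in> S) - 1 + of_bool (x = 0)" for x :: 'a
    using quadratic_character_nonzero[of x] by (auto simp: S_def)
  have "(\<Sum>x\<in>(UNIV :: 'a set). 2 * of_bool (x \<in> S) - 1 + of_bool (x = 0) :: int) = 0"
    using sum_quadratic_character[OF neq] by (simp only: c)
  then have "2 * int (card S) - int CARD('a) + 1 = 0"
    by (simp add: sum.distrib sum_subtractf flip: sum_distrib_left)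
  then have card: "CARD('a) = 2 * card S + 1" by linarith
  have inv: "inverse x \<in> S" if "x \<in> S" for x
  proof -
    from that obtain y where "y \<noteq> 0" "x = y\<^sup>2"
      by (auto simp: S_def quadratic_character_eq_1_iff)
    then have "inverse y \<noteq> 0" "inverse x = (inverse y)\<^sup>2" by (auto simp: power_inverse)
    then show ?thesis by (auto simp: S_def)
  qed
  have "even (card (S - {1, - 1}))"
  proof (rule even_card_involution[where f = inverse])
    fix x assume x: "x \<in> S - {1, - 1}"
    then have "x \<noteq> 0" by (auto simp: S_def)
    have "inverse x \<noteq> x"
    proof
      assume "inverse x = x"
      then have "x\<^sup>2 = 1\<^sup>2" using \<open>x \<noteq> 0\<close> by (metis left_inverse one_power2 power2_eq_square)
      then show False using x unfolding power2_eq_iff by blast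
    qed
    moreover have "inverse x \<notin> {1, - 1}"
      using x by (metis DiffD2 insert_iff inverse_1 inverse_inverse_eq inverse_minus_eq singletonD)
    ultimately show "inverse x \<in> S - {1, - 1} \<and> inverse x \<noteq> x \<and> inverse (inverse x) = x"
      using inv x by auto
  qed auto
  moreover have "card S = card (S - {1, - 1}) + card (S \<inter> {1, - 1})"
    by (metis Int_Diff_disjoint Un_Diff_Int Int_commute card_Un_disjoint finite Int_Diff)
  moreover have "S \<inter> {1, - 1} = (if - 1 \<in> S then {1, - 1} else {1})" by (auto simp: S_def)
  \<comment> \<open>The element 1 always lies in \<open>S\<close>, so inversion has two fixed points
    on \<open>S\<close> or one, according to whether -1 lies in \<open>S\<close>.\<close>
  ultimately have "even (card S) \<longleftrightarrow> - 1 \<in> S" using neq by (simp split: if_splits)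
  moreover have "even (card S) \<longleftrightarrow> CARD('a) mod 4 = 1" using card by presburger
  ultimately show ?thesis using c[of "- 1"] by auto
qed

section \<open>Adding one variable to the equation\<close>

lemma N_star_0: "N_star 0 a b = of_bool (b = 0)"
  by (auto simp: N_star_def)

text \<open>Fixing the last coordinate changes the right-hand side, so the induction has to treat
  every \<open>b\<close>, not just 0.\<close>

lemma N_star_Suc:
  fixes a :: "nat \<Rightarrow> 'a :: finite_field"
  shows "N_star (Suc n) a b = (\<Sum>x\<in>UNIV - {0}. N_star n a (b - a (Suc n) * x\<^sup>2))"
proof -
  let ?V = "\<lambda>c. {x \<in> {1..n} \<rightarrow>\<^sub>E (UNIV - {0}). (\<Sum>i=1..n. a i * x i ^ 2) = c}"
  let ?F = "\<lambda>(t, g). g(Suc n := t)"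
  have fin: "finite (?V c)" for c by (rule finite_subset[of _ "{1..n} \<rightarrow>\<^sub>E (UNIV - {0})"]) (auto intro!: finite_PiE)
  have upd: "(\<Sum>i=1..n. a i * (g(Suc n := t)) i ^ 2) = (\<Sum>i=1..n. a i * g i ^ 2)" for g t
    by (intro sum.cong) auto
  have "{x \<in> {1..Suc n} \<rightarrow>\<^sub>E (UNIV - {0}). (\<Sum>i=1..Suc n. a i * x i ^ 2) = b} =
        ?F ` (SIGMA t:UNIV - {0}. ?V (b - a (Suc n) * t\<^sup>2))"
    (is "?L = ?R")
  proof -
    have ins: "{1..Suc n} \<rightarrow>\<^sub>E (UNIV - {0}) =
        ?F ` ((UNIV - {0}) \<times> ({1..n} \<rightarrow>\<^sub>E (UNIV - {0 :: 'a})))"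
      using PiE_insert_eq[of "Suc n" "{1..n}" "\<lambda>_. UNIV - {0 :: 'a}"]
        atLeastAtMostSuc_conv[of 1 n] by simp
    have sum_Suc: "(\<Sum>i=1..Suc n. a i * x i ^ 2) = (\<Sum>i=1..n. a i * x i ^ 2) + a (Suc n) * x (Suc n) ^ 2"
      for x by simp
    have "?L = {x \<in> ?F ` ((UNIV - {0}) \<times> ({1..n} \<rightarrow>\<^sub>E (UNIV - {0}))).
        (\<Sum>i=1..n. a i * x i ^ 2) + a (Suc n) * x (Suc n) ^ 2 = b}"
      by (simp only: ins sum_Suc)
    also have "\<dots> = ?F ` {p \<in> (UNIV - {0}) \<times> ({1..n} \<rightarrow>\<^sub>E (UNIV - {0})).
        (\<Sum>i=1..n. a i * snd p i ^ 2) + a (Suc n) * fst p ^ 2 = b}"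
      by (auto simp only: Compr_image_eq case_prod_beta upd fun_upd_same)
    also have "\<dots> = ?R" by (intro arg_cong[where f = "(`) ?F"]) (auto simp: eq_diff_eq)
    finally show ?thesis .
  qed
  \<comment> \<open>Extensional functions are \<open>undefined\<close> at \<open>Suc n\<close>, so
    the update there loses no information.\<close>
  moreover have "inj_on ?F (SIGMA t:UNIV - {0}. ?V (b - a (Suc n) * t\<^sup>2))"
    by (rule inj_on_subset[OF inj_combinator[of "Suc n" "{1..n}" "\<lambda>_. UNIV - {0}"]]) auto
  ultimately show ?thesis
    unfolding N_star_def by (simp add: card_image fin[simplified] card_SigmaI)
qed

text \<open>The equation \<open>c * x\<^sup>2 = y\<close> has as many roots as \<open>y / c\<close>
  has square roots, and \<open>y / c\<close> and \<open>c * y\<close> have the same character.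
  Subtracting \<open>f 0\<close> removes \<open>x = 0\<close>.\<close>

lemma sum_over_scaled_squares:
  fixes f :: "'a :: finite_field \<Rightarrow> 'b :: comm_ring_1"
  assumes "(1 :: 'a) \<noteq> - 1" and "c \<noteq> 0"
  shows "(\<Sum>x\<in>UNIV - {0}. f (c * x\<^sup>2)) =
    (\<Sum>y\<in>UNIV. (1 + of_int (quadratic_character c) * of_int (quadratic_character y)) * f y) - f 0"
proof -
  have "(\<Sum>x\<in>UNIV - {0}. f (c * x\<^sup>2)) = (\<Sum>x\<in>UNIV. f (c * x\<^sup>2)) - f 0"
    by (simp add: sum_diff1)
  also have "(\<Sum>x\<in>UNIV. f (c * x\<^sup>2)) =
      (\<Sum>y\<in>UNIV. (1 + of_int (quadratic_character y)) * f (c * y))"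
    by (rule sum_over_squares[OF assms(1)])
  also have "\<dots> = (\<Sum>y\<in>UNIV. (1 + of_int (quadratic_character c * quadratic_character (c * y))) * f (c * y))"
    using quadratic_character_mult_self[OF assms(2)]
    by (simp add: quadratic_character_mult[OF assms(1)] flip: mult.assoc)
  also have "\<dots> = (\<Sum>y\<in>UNIV. (1 + of_int (quadratic_character c * quadratic_character y)) * f y)"
    by (rule sum.reindex_bij_witness[of _ "\<lambda>y. y / c" "\<lambda>y. c * y"]) (use assms in auto)
  finally show ?thesis by simp
qed

text \<open>
  The shape of the formula comes from additive characters: with \<open>w\<close> the quadratic Gauss sum, the
  factors of the two products are the values of \<open>\<Sum>x\<noteq>0. \<psi> (t * a i * x\<^sup>2)\<close> for \<open>t\<close> a square and
  for \<open>t\<close> a non-square.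
\<close>
lemma N_star_formula:
  fixes a :: "nat \<Rightarrow> 'a :: finite_field" and w :: complex
  defines "\<eta> \<equiv> \<lambda>x :: 'a. of_int (quadratic_character x) :: complex"
    and "q \<equiv> of_nat CARD('a) :: complex"
    and "P \<equiv> \<lambda>n. \<Prod>i=1..n. of_int (quadratic_character (a i)) * w - 1"
    and "M \<equiv> \<lambda>n. \<Prod>i=1..n. - of_int (quadratic_character (a i)) * w - 1"
  assumes neq: "(1 :: 'a) \<noteq> - 1" and w: "w\<^sup>2 = \<eta> (- 1) * q"
    and nz: "\<And>i. i \<in> {1..n} \<Longrightarrow> a i \<noteq> 0"
  shows "2 * q * of_nat (N_star n a b) = 2 * (q - 1) ^ n + (P n + M n) * (q * of_bool (b = 0) - 1)
           + (P n - M n) * w * \<eta> (- 1) * \<eta> b"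
  using nz
proof (induction n arbitrary: b)
  case 0
  then show ?case by (simp add: N_star_0 P_def M_def algebra_simps)
next
  case (Suc n)
  define \<epsilon> where "\<epsilon> = \<eta> (- 1)"
  define \<alpha> where "\<alpha> = \<eta> (a (Suc n))"
  define S where "S = P n + M n"
  define D where "D = P n - M n"
  \<comment> \<open>\<open>G\<close> is the claimed right-hand side for \<open>n\<close> as a
    function of \<open>b\<close>; \<open>S\<close> and \<open>D * w * \<epsilon>\<close> are its
    coordinates along \<open>u\<close> and \<open>\<eta>\<close>.\<close>
  define G where "G = (\<lambda>b. 2 * (q - 1) ^ n + S * (q * of_bool (b = 0) - 1) + D * w * \<epsilon> * \<eta> b)"
  have eps: "\<epsilon> * \<epsilon> = 1"
    unfolding \<epsilon>_def \<eta>_def by (simp add: quadratic_character_mult_self flip: of_int_mult)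
  have P: "P (Suc n) = P n * (\<alpha> * w - 1)" and M: "M (Suc n) = M n * (- \<alpha> * w - 1)"
    by (simp_all add: P_def M_def \<alpha>_def \<eta>_def)
  have "a (Suc n) \<noteq> 0" using Suc.prems by simp
  have IH: "2 * q * of_nat (N_star n a b) = G b" for b
    unfolding G_def S_def D_def \<epsilon>_def using Suc by simp
  have s1: "(\<Sum>y\<in>UNIV. \<eta> y) = 0"
    using sum_quadratic_character[OF neq] unfolding \<eta>_def by (metis of_int_0 of_int_sum)
  have s1': "(\<Sum>y\<in>UNIV. \<eta> (b - y)) = 0"
    using sum_reflect[of \<eta> b] s1 by simp
  have J: "(\<Sum>y\<in>UNIV. \<eta> y * \<eta> (b - y)) = \<epsilon> * (q * of_bool (b = 0) - 1)"
    using arg_cong[OF jacobi_sum_quadratic_character[OF neq, of b], of "of_int :: int \<Rightarrow> complex"]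
    by (simp add: \<eta>_def \<epsilon>_def q_def of_bool_def)
  have d: "(\<Sum>y\<in>UNIV. h y * of_bool (b - y = 0)) = h b" for h :: "'a \<Rightarrow> complex"
    by (simp add: of_bool_def if_distrib cong: if_cong)
  have "2 * q * of_nat (N_star (Suc n) a b) =
      (\<Sum>x\<in>UNIV - {0}. G (b - a (Suc n) * x\<^sup>2))"
    by (simp add: N_star_Suc sum_distrib_left IH)
  also have "\<dots> = (\<Sum>y\<in>UNIV. (1 + \<alpha> * \<eta> y) * G (b - y)) - G b"
    using sum_over_scaled_squares[OF neq \<open>a (Suc n) \<noteq> 0\<close>, of "\<lambda>y. G (b - y)"]
    by (simp add: \<alpha>_def \<eta>_def)
  \<comment> \<open>Expanded so that each summand is a constant, a character, a delta term or a
    Jacobi term, whose sums are known.\<close>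
  also have "(\<Sum>y\<in>UNIV. (1 + \<alpha> * \<eta> y) * G (b - y)) =
      (\<Sum>y\<in>UNIV. (2 * (q - 1) ^ n - S) + (2 * (q - 1) ^ n - S) * \<alpha> * \<eta> y
        + S * q * ((1 + \<alpha> * \<eta> y) * of_bool (b - y = 0))
        + D * w * \<epsilon> * \<eta> (b - y) + D * w * \<epsilon> * \<alpha> * (\<eta> y * \<eta> (b - y)))"
    by (intro sum.cong) (auto simp: G_def algebra_simps)
  also have "\<dots> = q * (2 * (q - 1) ^ n - S) + S * q * (1 + \<alpha> * \<eta> b)
      + D * w * \<epsilon> * \<alpha> * (\<epsilon> * (q * of_bool (b = 0) - 1))"
    by (simp only: sum.distrib d J s1 s1' flip: sum_distrib_left) (simp add: q_def)
  also have "\<dots> - G b = 2 * (q - 1) ^ Suc n + (\<alpha> * w * D - S) * (q * of_bool (b = 0) - 1)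
      + (\<alpha> * q * S - D * w * \<epsilon>) * \<eta> b"
  proof -
    have "D * w * \<epsilon> * \<alpha> * (\<epsilon> * X) = (\<epsilon> * \<epsilon>) * (\<alpha> * w * D * X)" for X by simp
    then have "D * w * \<epsilon> * \<alpha> * (\<epsilon> * X) = \<alpha> * w * D * X" for X by (simp add: eps)
    then show ?thesis by (simp only: G_def) (simp add: algebra_simps)
  qed
  \<comment> \<open>In terms of \<open>P\<close> and \<open>M\<close> the update is diagonal, with
    factors \<open>\<alpha> * w - 1\<close> and \<open>- \<alpha> * w - 1\<close>.\<close>
  also have "\<alpha> * w * D - S = P (Suc n) + M (Suc n)"
    unfolding P M S_def D_def by (simp add: algebra_simps)
  \<comment> \<open>This is where the choice of \<open>w\<close> enters, through
    \<open>w\<^sup>2 * \<epsilon> = q\<close>.\<close>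
  also have "\<alpha> * q * S - D * w * \<epsilon> = (P (Suc n) - M (Suc n)) * w * \<epsilon>"
  proof -
    have "(P (Suc n) - M (Suc n)) * w * \<epsilon> = \<alpha> * S * (w\<^sup>2 * \<epsilon>) - D * w * \<epsilon>"
      unfolding P M S_def D_def by (simp add: algebra_simps power2_eq_square)
    also have "w\<^sup>2 * \<epsilon> = (\<epsilon> * \<epsilon>) * q" using w by (simp add: \<epsilon>_def)
    finally show ?thesis by (simp add: eps)
  qed
  finally show ?case unfolding \<epsilon>_def .
qed

section \<open>The closed formula at zero\<close>

text \<open>Each factor is \<open>- (1 - w)\<close> at a square coefficient and
  \<open>- (1 + w)\<close> at a non-square. Taking \<open>w\<close> and \<open>- w\<close> yields
  the two products in \<open>N_star_formula\<close>.\<close>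

lemma prod_quadratic_character:
  fixes a :: "nat \<Rightarrow> 'a :: finite_field" and w :: complex
  assumes "\<And>i. i \<in> {1..n} \<Longrightarrow> a i \<noteq> 0"
    and "m = card {i \<in> {1..n}. quadratic_character (a i) = 1}"
  shows "(\<Prod>i=1..n. of_int (quadratic_character (a i)) * w - 1) =
           (- 1) ^ n * ((1 - w) ^ m * (1 + w) ^ (n - m))"
proof -
  let ?A = "{i \<in> {1..n}. quadratic_character (a i) = 1}"
  have "(\<Prod>i=1..n. of_int (quadratic_character (a i)) * w - 1) =
      (\<Prod>i=1..n. - 1 * (if i \<in> ?A then 1 - w else 1 + w))"
    using assms(1) quadratic_character_nonzero by (intro prod.cong) fastforce+
  also have "\<dots> = (- 1) ^ n * ((\<Prod>i\<in>{1..n} \<inter> ?A. 1 - w) * (\<Prod>i\<in>{1..n} \<inter> - ?A. 1 + w))"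
    by (simp only: prod.distrib prod.If_cases[OF finite_atLeastAtMost] Collect_mem_eq) simp
  also have "{1..n} \<inter> ?A = ?A" by auto
  also have "{1..n} \<inter> - ?A = {1..n} - ?A" by auto
  also have "(\<Prod>i\<in>{1..n} - ?A. 1 + w) = (1 + w) ^ (n - m)"
    by (subst prod_constant, subst card_Diff_subset) (auto simp: assms(2))
  also have "(\<Prod>i\<in>?A. 1 - w) = (1 - w) ^ m" by (simp add: assms(2))
  finally show ?thesis .
qed

text \<open>At \<open>b = 0\<close> the character term vanishes and the delta factor becomes
  \<open>q - 1\<close>. Leaving the root \<open>w\<close> open covers both cases of the
  theorem.\<close>

lemma N_star_zero_formula:
  fixes a :: "nat \<Rightarrow> 'a :: finite_field" and w :: complex
  assumes odd: "odd CARD('a)" and q: "CARD('a) = q"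
    and w: "w\<^sup>2 = of_int (quadratic_character (- 1 :: 'a)) * of_nat q"
    and nz: "\<And>i. i \<in> {1..n} \<Longrightarrow> a i \<noteq> 0"
    and m: "m = card {i \<in> {1..n}. quadratic_character (a i) = 1}"
  shows "of_nat (N_star n a 0) =
           (of_nat q - 1) ^ n / of_nat q + (- 1) ^ n * ((of_nat q - 1) / (2 * of_nat q)) *
             ((1 - w) ^ m * (1 + w) ^ (n - m) + (1 + w) ^ m * (1 - w) ^ (n - m))"
proof -
  have "(of_nat q :: complex) \<noteq> 0" using q by auto
  moreover have "2 * of_nat q * of_nat (N_star n a 0) = 2 * (of_nat q - 1) ^ n +
      ((- 1) ^ n * ((1 - w) ^ m * (1 + w) ^ (n - m)) + (- 1) ^ n * ((1 + w) ^ m * (1 - w) ^ (n - m)))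
        * (of_nat q - 1)"
    using N_star_formula[OF one_neq_minus_one_if_odd_card[OF odd] w[folded q] nz, where b = 0]
      prod_quadratic_character[OF nz m, of w] prod_quadratic_character[OF nz m, of "- w"] q
    by simp
  ultimately show ?thesis by (simp add: field_simps)
qed

theorem theorem3p5:
  fixes p s q n m :: nat and a :: "nat \<Rightarrow> 'a :: finite_field"
  assumes "prime p" and "odd p" and "s \<ge> 1" and "q = p ^ s" and "CARD('a) = q"
    and "n \<ge> 1" and "\<And>i. i \<in> {1..n} \<Longrightarrow> a i \<noteq> 0"
    and "m = card {i \<in> {1..n}. quadratic_character (a i) = 1}"
  shows "(p mod 4 = 1 \<or> (p mod 4 = 3 \<and> even s) \<longrightarrow>
           real (N_star n a 0) =
             (real q - 1) ^ n / real q + (- 1) ^ n * ((real q - 1) / (2 * real q)) *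
               ((1 - sqrt (real q)) ^ m * (1 + sqrt (real q)) ^ (n - m) +
                (1 + sqrt (real q)) ^ m * (1 - sqrt (real q)) ^ (n - m))) \<and>
         (p mod 4 = 3 \<and> odd s \<longrightarrow>
           (of_nat (N_star n a 0) :: complex) =
             (of_nat q - 1) ^ n / of_nat q + (- 1) ^ n * ((of_nat q - 1) / (2 * of_nat q)) *
               ((1 - complex_of_real (sqrt (real q)) * \<i>) ^ m *
                (1 + complex_of_real (sqrt (real q)) * \<i>) ^ (n - m) +
                (1 + complex_of_real (sqrt (real q)) * \<i>) ^ m *
                (1 - complex_of_real (sqrt (real q)) * \<i>) ^ (n - m)))"
proof -
  have odd: "odd CARD('a)" using assms by simp
  note formula = N_star_zero_formula[OF odd assms(5) _ assms(7,8)]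
  have sq: "(complex_of_real (sqrt (real q)))\<^sup>2 = of_nat q"
    by (simp flip: of_real_power)
  have pow3: "(3 :: nat) ^ k mod 4 = (if even k then 1 else 3)" for k
    by (induction k) (auto simp: mod_mult_right_eq[of 3 "3 ^ _", symmetric])
  have qmod: "q mod 4 = (p mod 4) ^ s mod 4" using assms(4) by (simp add: power_mod)
  show ?thesis
  proof (intro conjI impI)
    assume "p mod 4 = 1 \<or> (p mod 4 = 3 \<and> even s)"
    then have "q mod 4 = 1" using qmod pow3[of s] by auto
    then have chi: "quadratic_character (- 1 :: 'a) = 1"
      using quadratic_character_minus_1[OF odd] assms(5) by simp
    \<comment> \<open>Here \<open>w = sqrt q\<close> is real, so the complex identity descends to
      the reals by injectivity of the embedding.\<close>
    have "complex_of_real (real (N_star n a 0)) = complex_of_real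
        ((real q - 1) ^ n / real q + (- 1) ^ n * ((real q - 1) / (2 * real q)) *
               ((1 - sqrt (real q)) ^ m * (1 + sqrt (real q)) ^ (n - m) +
                (1 + sqrt (real q)) ^ m * (1 - sqrt (real q)) ^ (n - m)))"
      using formula[of "complex_of_real (sqrt (real q))"] by (simp add: sq chi)
    then show "real (N_star n a 0) =
             (real q - 1) ^ n / real q + (- 1) ^ n * ((real q - 1) / (2 * real q)) *
               ((1 - sqrt (real q)) ^ m * (1 + sqrt (real q)) ^ (n - m) +
                (1 + sqrt (real q)) ^ m * (1 - sqrt (real q)) ^ (n - m))"
      by (simp only: of_real_eq_iff)
  next
    assume "p mod 4 = 3 \<and> odd s"
    then have "q mod 4 = 3" using qmod pow3[of s] by auto
    then have chi: "quadratic_character (- 1 :: 'a) = - 1"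
      using quadratic_character_minus_1[OF odd] assms(5) by simp
    show "(of_nat (N_star n a 0) :: complex) =
             (of_nat q - 1) ^ n / of_nat q + (- 1) ^ n * ((of_nat q - 1) / (2 * of_nat q)) *
               ((1 - complex_of_real (sqrt (real q)) * \<i>) ^ m *
                (1 + complex_of_real (sqrt (real q)) * \<i>) ^ (n - m) +
                (1 + complex_of_real (sqrt (real q)) * \<i>) ^ m *
                (1 - complex_of_real (sqrt (real q)) * \<i>) ^ (n - m))"
      \<comment> \<open>Here \<open>w = sqrt q * \<i>\<close>, whose square is \<open>- q\<close>,
        as the character at -1 requires.\<close>
      by (rule formula) (simp add: power_mult_distrib sq chi)
  qed
qed

end
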